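(* Let $X$ be an infinite dimensional separable Banach space, let $(x_n)_{n\in\mathbb{N}}\subset X$ be a dense sequence, and let $(L_n)_{n\in\mathbb{N}}$ be a subsequence of the sequence of subspaces $\operatorname{span}\{x_1,\dots,x_n\}$ such that $L_n\subsetneq L_{n+1}$ for every $n$. Set $L:=\bigcup_{n\in\mathbb{N}}L_n$. Let $(\alpha_n)\subset\mathbb{R}$ be a strictly increasing sequence with $\lim_{n\to\infty}\alpha_n=1$. Define $f:X\to\mathbb{R}$ by $f(x)=1$ if $x\in X\setminus L$, $f(x)=\alpha_1$ if $x\in L_1$, and $f(x)=\alpha_n$ if $x\in L_n\setminus L_{n-1}$, $n\ge2$. Then the set of points where $f$ is Hadamard differentiable is of first category in $X$.
   Context: Banach spaces are real. First category means a countable union of nowhere dense subsets of $X$. A function $f:X\to\mathbb{R}$ is Gâteaux differentiable at $x$ with derivative $Df(x)\in X^*$ if $Df(x)h=\lim_{t\to0}\frac{f(x+th)-f(x)}{t}$ for every $h\in X$; it is Hadamard differentiable at $x$ if moreover the limit is uniform for $h$ in every compact subset of $X$. *)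

theory Defs
  imports "HOL-Analysis.Analysis"
begin

definition infinite_dimensional :: "'a::real_vector set \<Rightarrow> bool" where
  "infinite_dimensional V \<longleftrightarrow> \<not> (\<exists>B. finite B \<and> V \<subseteq> span B)"

definition nowhere_dense :: "'a::topological_space set \<Rightarrow> bool" where
  "nowhere_dense S \<longleftrightarrow> interior (closure S) = {}"

definition first_category :: "'a::topological_space set \<Rightarrow> bool" where
  "first_category S \<longleftrightarrow>
     (\<exists>F. countable F \<and> (\<forall>N\<in>F. nowhere_dense N) \<and> S = \<Union>F)"

text \<open>Derivatives are elements of the topological dual, rendered as bounded linear functionals
  of type \<^typ>\<open>'a::real_normed_vector \<Rightarrow>\<^sub>L real\<close>.\<close>

definition has_gateaux_derivative ::
  "('a::real_normed_vector \<Rightarrow> real) \<Rightarrow> ('a \<Rightarrow>\<^sub>L real) \<Rightarrow> 'a \<Rightarrow> bool" where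
  "has_gateaux_derivative f D x \<longleftrightarrow>
     (\<forall>h. ((\<lambda>t. (f (x + t *\<^sub>R h) - f x) / t) \<longlongrightarrow> blinfun_apply D h) (at 0))"

definition has_hadamard_derivative ::
  "('a::real_normed_vector \<Rightarrow> real) \<Rightarrow> ('a \<Rightarrow>\<^sub>L real) \<Rightarrow> 'a \<Rightarrow> bool" where
  "has_hadamard_derivative f D x \<longleftrightarrow>
     has_gateaux_derivative f D x \<and>
     (\<forall>K. compact K \<longrightarrow>
        uniform_limit K (\<lambda>t h. (f (x + t *\<^sub>R h) - f x) / t) (blinfun_apply D) (at 0))"

definition hadamard_differentiable_at ::
  "('a::real_normed_vector \<Rightarrow> real) \<Rightarrow> 'a \<Rightarrow> bool" where
  "hadamard_differentiable_at f x \<longleftrightarrow> (\<exists>D. has_hadamard_derivative f D x)"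

end

theory Submission
  imports Defs
begin

text \<open>The function \<open>f\<close> is at most \<open>\<alpha> n\<close> on \<open>L n\<close> and at least \<open>\<alpha> (Suc n)\<close> off \<open>L n\<close>. The
  levels \<open>L n\<close> exhaust a dense set, so almost every point, in the sense of category, is so close to
  the levels that these drops spoil differentiability.

  At a point \<open>y\<close> of \<open>L\<close>, with \<open>m\<close> the least index such that \<open>y \<in> L m\<close>, every line through \<open>y\<close>
  in a direction outside \<open>L m\<close> leaves \<open>L m\<close> at once, and \<open>f\<close> jumps by at least
  \<open>\<alpha> (Suc m) - \<alpha> m\<close>. So \<open>f\<close> is discontinuous along that line and not even Gateaux differentiable
  (\<open>not_gateaux_differentiable_on_levels\<close>).

  At a point \<open>y\<close> outside \<open>L\<close> we have \<open>f y = 1\<close>. Suppose that, for infinitely many \<open>n\<close>, the distance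
  from \<open>y\<close> to some \<open>z \<in> L n\<close> is less than \<open>(1 - \<alpha> n)\<^sup>2\<close>. Write \<open>z = y + t *\<^sub>R h\<close> with
  \<open>t = 1 - \<alpha> n\<close>. Then \<open>norm h \<le> 1 - \<alpha> n\<close>, so these directions form a null sequence, which together
  with its limit is compact, whereas the difference quotients are at most \<open>-1\<close>. A Hadamard
  derivative would force them to tend to \<open>0\<close> (\<open>not_hadamard_differentiable_if_well_approximated\<close>).

  For each \<open>m\<close>, the points approximated in this way for some \<open>n \<ge> m\<close> form an open set containing
  \<open>L m\<close>, \<open>L (Suc m)\<close>, \<dots>, hence all of \<open>L\<close>, which is dense. Its complement is therefore nowhere
  dense, and every point of Hadamard differentiability lies in one of these countably many
  complements.\<close>

lemma first_category_subset_UN: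
  fixes N :: "nat \<Rightarrow> 'a::topological_space set"
  assumes "\<And>n. nowhere_dense (N n)" and "S \<subseteq> (\<Union>n. N n)"
  shows "first_category S"
proof -
  have "nowhere_dense (S \<inter> N n)" for n
    using assms(1)[of n] interior_mono[OF closure_mono[of "S \<inter> N n" "N n"]]
    unfolding nowhere_dense_def by auto
  moreover have "S = \<Union> (range (\<lambda>n. S \<inter> N n))"
    using assms(2) by auto
  ultimately show ?thesis
    unfolding first_category_def by (intro exI[of _ "range (\<lambda>n. S \<inter> N n)"]) auto
qed

lemma nowhere_dense_Compl_open_dense:
  assumes "open G" and "closure G = UNIV"
  shows "nowhere_dense (- G)"
  using assms by (simp add: nowhere_dense_def closure_complement interior_open interior_complement)

text \<open>In any open cover, a member containing the limit already covers all but finitely many terms.\<close>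

lemma compact_insert_limit_range:
  fixes h :: "nat \<Rightarrow> 'a::topological_space"
  assumes "h \<longlonglongrightarrow> l"
  shows "compact (insert l (range h))"
proof (rule compactI)
  fix C assume C: "\<forall>U\<in>C. open U" "insert l (range h) \<subseteq> \<Union>C"
  then obtain U where U: "U \<in> C" "l \<in> U" by auto
  then have "\<forall>\<^sub>F n in sequentially. h n \<in> U"
    using C(1) assms by (auto dest: topological_tendstoD)
  then obtain N where N: "\<And>n. n \<ge> N \<Longrightarrow> h n \<in> U"
    by (auto simp: eventually_sequentially)
  have "\<forall>n. \<exists>V\<in>C. h n \<in> V"
    using C(2) by auto
  then obtain V where V: "\<And>n. V n \<in> C" "\<And>n. h n \<in> V n"
    by metis
  have "h n \<in> \<Union> (insert U (V ` {..<N}))" for n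
    using N[of n] V(2)[of n] by (cases "n < N") auto
  then show "\<exists>C'\<subseteq>C. finite C' \<and> insert l (range h) \<subseteq> \<Union>C'"
    using U V(1) by (intro exI[of _ "insert U (V ` {..<N})"]) auto
qed

text \<open>The sequential form of Hadamard differentiability, in which the direction may vary with the
  step: a convergent sequence of directions together with its limit is a compact set, on which
  the quotients converge uniformly.\<close>

lemma hadamard_derivative_sequentially:
  fixes f :: "'a::real_normed_vector \<Rightarrow> real"
  assumes D: "has_hadamard_derivative f D y"
    and h: "h \<longlonglongrightarrow> l"
    and t: "t \<longlonglongrightarrow> 0" "\<And>n. t n \<noteq> 0"
  shows "(\<lambda>n. (f (y + t n *\<^sub>R h n) - f y) / t n) \<longlonglongrightarrow> blinfun_apply D l"
proof -
  let ?q = "\<lambda>s v. (f (y + s *\<^sub>R v) - f y) / s"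
  let ?K = "insert l (range h)"
  have "compact ?K"
    using h by (rule compact_insert_limit_range)
  then have unif: "uniform_limit ?K ?q (blinfun_apply D) (at 0)"
    using D by (simp add: has_hadamard_derivative_def)
  have t0: "filterlim t (at 0) sequentially"
    using t by (simp add: filterlim_at)
  have "(\<lambda>n. ?q (t n) (h n) - blinfun_apply D (h n)) \<longlonglongrightarrow> 0"
  proof (rule tendstoI)
    fix e :: real assume "e > 0"
    then have "\<forall>\<^sub>F s in at 0. \<forall>v\<in>?K. dist (?q s v) (blinfun_apply D v) < e"
      using unif by (simp add: uniform_limit_iff)
    from eventually_compose_filterlim[OF this t0]
    show "\<forall>\<^sub>F n in sequentially. dist (?q (t n) (h n) - blinfun_apply D (h n)) 0 < e"
      by (rule eventually_mono) (simp add: dist_norm)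
  qed
  moreover have "(\<lambda>n. blinfun_apply D (h n)) \<longlonglongrightarrow> blinfun_apply D l"
    using h by (intro tendsto_intros)
  ultimately have "(\<lambda>n. (?q (t n) (h n) - blinfun_apply D (h n)) + blinfun_apply D (h n))
      \<longlonglongrightarrow> 0 + blinfun_apply D l"
    by (rule tendsto_add)
  then show ?thesis by simp
qed

lemma gateaux_derivative_imp_continuous_along_lines:
  assumes "has_gateaux_derivative f D y"
  shows "((\<lambda>s. f (y + s *\<^sub>R h)) \<longlongrightarrow> f y) (at 0)"
proof -
  have "((\<lambda>s. (f (y + s *\<^sub>R h) - f y) / s * s + f y) \<longlongrightarrow> blinfun_apply D h * 0 + f y) (at 0)"
    using assms unfolding has_gateaux_derivative_def by (intro tendsto_intros) auto
  moreover have "\<forall>\<^sub>F s in at 0. (f (y + s *\<^sub>R h) - f y) / s * s + f y = f (y + s *\<^sub>R h)"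
    by (auto simp: eventually_at_filter)
  ultimately show ?thesis
    by (simp add: tendsto_cong)
qed

locale level_function =
  fixes L :: "nat \<Rightarrow> 'a::real_normed_vector set"
    and \<alpha> :: "nat \<Rightarrow> real"
    and f :: "'a \<Rightarrow> real"
  assumes subspace_level: "subspace (L n)"
    and level_psubset_Suc: "L n \<subset> L (Suc n)"
    and strict_mono_\<alpha>: "strict_mono \<alpha>"
    and \<alpha>_tendsto_1: "\<alpha> \<longlonglongrightarrow> 1"
    and f_off_levels: "y \<notin> (\<Union>n. L n) \<Longrightarrow> f y = 1"
    and f_level_0: "y \<in> L 0 \<Longrightarrow> f y = \<alpha> 0"
    and f_level_Suc: "y \<in> L (Suc n) - L n \<Longrightarrow> f y = \<alpha> (Suc n)"
begin

lemma level_mono: "m \<le> n \<Longrightarrow> L m \<subseteq> L n"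
  using level_psubset_Suc by (rule lift_Suc_mono_le[of L, OF psubset_imp_subset])

lemma \<alpha>_less_1: "\<alpha> n < 1"
proof -
  have "\<alpha> (Suc n) \<le> 1"
    using strict_mono_\<alpha> \<alpha>_tendsto_1 by (intro incseq_le strict_mono_mono)
  moreover have "\<alpha> n < \<alpha> (Suc n)"
    using strict_mono_\<alpha> by (simp add: strict_mono_less)
  ultimately show ?thesis by simp
qed

lemma f_eq_at_least_level:
  assumes "y \<in> L n"
  shows "f y = \<alpha> (LEAST m. y \<in> L m)"
proof (cases "LEAST m. y \<in> L m")
  case 0
  then show ?thesis
    using LeastI[of "\<lambda>m. y \<in> L m", OF assms] f_level_0 by simp
next
  case (Suc m)
  then have "y \<in> L (Suc m) - L m"
    using LeastI[of "\<lambda>m. y \<in> L m", OF assms] not_less_Least[of m "\<lambda>m. y \<in> L m"] by simp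
  then show ?thesis
    using f_level_Suc Suc by simp
qed

lemma f_le_on_level:
  assumes "y \<in> L n"
  shows "f y \<le> \<alpha> n"
  using f_eq_at_least_level[OF assms] strict_mono_\<alpha> Least_le[of "\<lambda>m. y \<in> L m", OF assms]
  by (simp add: strict_mono_less_eq)

lemma f_ge_off_level:
  assumes "y \<notin> L n"
  shows "\<alpha> (Suc n) \<le> f y"
proof (cases "y \<in> (\<Union>n. L n)")
  case True
  then obtain i where i: "y \<in> L i" by auto
  have "y \<in> L (LEAST m. y \<in> L m)"
    using i by (rule LeastI)
  then have "Suc n \<le> (LEAST m. y \<in> L m)"
    using level_mono[of "LEAST m. y \<in> L m" n] assms by (meson not_less_eq_eq subsetD)
  then show ?thesis
    using f_eq_at_least_level[OF i] strict_mono_\<alpha> by (simp add: strict_mono_less_eq)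
next
  case False
  then show ?thesis
    using f_off_levels \<alpha>_less_1[of "Suc n"] by simp
qed

text \<open>A line through \<open>y\<close> meets the smallest level containing \<open>y\<close> only in \<open>y\<close>, provided that its
  direction lies outside that level; \<open>f\<close> then jumps up at \<open>y\<close> along the line.\<close>

lemma not_gateaux_differentiable_on_levels:
  assumes "y \<in> L n"
  shows "\<not> has_gateaux_derivative f D y"
proof
  assume D: "has_gateaux_derivative f D y"
  define m where "m = (LEAST m. y \<in> L m)"
  have ym: "y \<in> L m"
    unfolding m_def using assms by (rule LeastI)
  have fy: "f y = \<alpha> m"
    unfolding m_def using assms by (rule f_eq_at_least_level)
  obtain h where h: "h \<notin> L m"
    using level_psubset_Suc[of m] by auto
  have "y + s *\<^sub>R h \<notin> L m" if "s \<noteq> 0" for s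
  proof
    assume "y + s *\<^sub>R h \<in> L m"
    then have "inverse s *\<^sub>R ((y + s *\<^sub>R h) - y) \<in> L m"
      using ym subspace_level[of m] by (intro subspace_scale subspace_diff)
    then show False
      using h that by simp
  qed
  then have "\<forall>\<^sub>F s in at 0. \<alpha> (Suc m) \<le> f (y + s *\<^sub>R h)"
    by (auto simp: eventually_at_filter f_ge_off_level)
  then have "\<alpha> (Suc m) \<le> f y"
    using gateaux_derivative_imp_continuous_along_lines[OF D, of h]
    by (intro tendsto_lowerbound) auto
  then show False
    using fy strict_mono_\<alpha> by (simp add: strict_mono_less_eq)
qed

text \<open>The radius is quadratic in the gap \<open>1 - \<alpha> n\<close> so that one factor can serve as the step of the
  difference quotient, while the other makes the direction small.\<close>

definition well_approximated :: "nat \<Rightarrow> 'a set" where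
  "well_approximated m = (\<Union>n\<in>{m..}. \<Union>z\<in>L n. ball z ((1 - \<alpha> n)\<^sup>2))"

lemma open_well_approximated: "open (well_approximated m)"
  unfolding well_approximated_def by auto

lemma levels_subset_well_approximated: "(\<Union>n. L n) \<subseteq> well_approximated m"
proof
  fix y assume "y \<in> (\<Union>n. L n)"
  then obtain n where "y \<in> L n" by auto
  then have "y \<in> L (max m n)"
    using level_mono[of n "max m n"] by auto
  moreover have "y \<in> ball y ((1 - \<alpha> (max m n))\<^sup>2)"
    using \<alpha>_less_1[of "max m n"] by simp
  ultimately show "y \<in> well_approximated m"
    unfolding well_approximated_def by (meson UN_I atLeast_iff max.cobounded1)
qed

text \<open>Moving from \<open>y\<close> to an approximating point of \<open>L n\<close> drops \<open>f\<close> by at least the step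
  \<open>1 - \<alpha> n\<close>, in a direction of norm at most \<open>1 - \<alpha> n\<close>. The quotients stay below \<open>-1\<close>, although
  the null sequence of directions would make them converge to the derivative in direction \<open>0\<close>.\<close>

lemma not_hadamard_differentiable_if_well_approximated:
  assumes off: "y \<notin> (\<Union>n. L n)" and approx: "\<And>m. y \<in> well_approximated m"
  shows "\<not> has_hadamard_derivative f D y"
proof
  assume D: "has_hadamard_derivative f D y"
  have "\<exists>n z. m \<le> n \<and> z \<in> L n \<and> dist z y < (1 - \<alpha> n)\<^sup>2" for m
    using approx[of m] unfolding well_approximated_def by auto
  then obtain r z where r: "\<And>m. m \<le> r m" and z: "\<And>m. z m \<in> L (r m)"
    and close: "\<And>m. dist (z m) y < (1 - \<alpha> (r m))\<^sup>2"
    by metis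
  define t where "t m = 1 - \<alpha> (r m)" for m
  define h where "h m = inverse (t m) *\<^sub>R (z m - y)" for m
  have t_pos: "t m > 0" for m
    using \<alpha>_less_1[of "r m"] by (simp add: t_def)
  have "filterlim r at_top sequentially"
    using r by (intro filterlim_at_top_mono[OF filterlim_ident]) auto
  then have "(\<lambda>m. \<alpha> (r m)) \<longlonglongrightarrow> 1"
    by (rule filterlim_compose[OF \<alpha>_tendsto_1])
  then have "t \<longlonglongrightarrow> 1 - 1"
    unfolding t_def by (intro tendsto_intros)
  then have t0: "t \<longlonglongrightarrow> 0" by simp
  have "norm (h m) \<le> t m" for m
  proof -
    have "norm (h m) = norm (z m - y) / t m"
      using t_pos[of m] by (simp add: h_def divide_inverse_commute)
    also have "\<dots> \<le> t m"
      using close[of m] t_pos[of m] unfolding t_def[symmetric]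
      by (simp add: dist_norm power2_eq_square pos_divide_le_eq)
    finally show ?thesis .
  qed
  then have h0: "h \<longlonglongrightarrow> 0"
    using t0 by (intro Lim_null_comparison[of h t]) auto
  have quotient: "(f (y + t m *\<^sub>R h m) - f y) / t m \<le> -1" for m
  proof -
    have "y + t m *\<^sub>R h m = z m"
      using t_pos[of m] by (simp add: h_def)
    moreover have "f (z m) \<le> 1 - t m"
      using f_le_on_level[OF z] by (simp add: t_def)
    ultimately show ?thesis
      using f_off_levels[OF off] t_pos[of m] by (simp add: field_simps)
  qed
  have "(\<lambda>m. (f (y + t m *\<^sub>R h m) - f y) / t m) \<longlonglongrightarrow> blinfun_apply D 0"
    using D h0 t0 t_pos by (intro hadamard_derivative_sequentially) (simp_all add: less_imp_neq[THEN not_sym])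
  then have "blinfun_apply D 0 \<le> -1"
    using quotient by (intro LIMSEQ_le_const2) auto
  then show False
    by simp
qed

theorem first_category_hadamard_differentiable:
  assumes dense: "closure (\<Union>n. L n) = UNIV"
  shows "first_category {y. hadamard_differentiable_at f y}"
proof (rule first_category_subset_UN)
  fix m
  have "closure (well_approximated m) = UNIV"
    using closure_mono[OF levels_subset_well_approximated] dense by (metis top.extremum_uniqueI)
  then show "nowhere_dense (- well_approximated m)"
    using open_well_approximated by (intro nowhere_dense_Compl_open_dense)
next
  show "{y. hadamard_differentiable_at f y} \<subseteq> (\<Union>m. - well_approximated m)"
  proof
    fix y assume "y \<in> {y. hadamard_differentiable_at f y}"
    then obtain D where D: "has_hadamard_derivative f D y"
      by (auto simp: hadamard_differentiable_at_def)
    then have "y \<notin> (\<Union>n. L n)"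
      using not_gateaux_differentiable_on_levels unfolding has_hadamard_derivative_def by auto
    then show "y \<in> (\<Union>m. - well_approximated m)"
      using D not_hadamard_differentiable_if_well_approximated by blast
  qed
qed

end

theorem theorem7p2:
  fixes x :: "nat \<Rightarrow> 'a::banach"
    and k :: "nat \<Rightarrow> nat"
    and L :: "nat \<Rightarrow> 'a set"
    and \<alpha> :: "nat \<Rightarrow> real"
    and f :: "'a \<Rightarrow> real"
  assumes "infinite_dimensional (UNIV :: 'a set)"
    and "separable_space (euclidean :: 'a topology)"
    and "closure (range x) = UNIV"
    and "strict_mono k"
    and "\<And>n. L n = span (x ` {..k n})"
    and "\<And>n. L n \<subset> L (Suc n)"
    and "strict_mono \<alpha>"
    and "\<alpha> \<longlonglongrightarrow> 1"
    and "\<And>y. y \<in> UNIV - (\<Union>n. L n) \<Longrightarrow> f y = 1"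
    and "\<And>y. y \<in> L 0 \<Longrightarrow> f y = \<alpha> 0"
    and "\<And>n y. y \<in> L (Suc n) - L n \<Longrightarrow> f y = \<alpha> (Suc n)"
  shows "first_category {y. hadamard_differentiable_at f y}"
proof -
  interpret level_function L \<alpha> f
  proof
    show "subspace (L n)" for n
      unfolding assms(5) by (rule subspace_span)
  qed (use assms(6-11) in auto)
  have "x n \<in> L n" for n
    unfolding assms(5) using strict_mono_imp_increasing[OF assms(4), of n]
    by (intro span_base) auto
  then have "range x \<subseteq> (\<Union>n. L n)" by auto
  then have "closure (\<Union>n. L n) = UNIV"
    using closure_mono assms(3) by (metis top.extremum_uniqueI)
  then show ?thesis
    by (rule first_category_hadamard_differentiable)
qed

end
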